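(* Let $P \subset \mathbb{R}^m$ and $Q \subset \mathbb{R}^n$ be full-dimensional convex polytopes such that $P$ contains the origin of $\mathbb{R}^m$ and $Q$ contains the origin of $\mathbb{R}^n$. Then \[ \operatorname{Vol}_{m+n}(P \oplus Q) = \operatorname{Vol}_m(P)\,\operatorname{Vol}_n(Q), \] where $P \oplus Q \subset \mathbb{R}^{m+n}$ is the free sum of $P$ and $Q$ and $\operatorname{Vol}_d$ denotes normalized $d$-dimensional volume.
   Context: A (convex) polytope in $\mathbb{R}^d$ is the convex hull of finitely many points of $\mathbb{R}^d$ (vertices are allowed to have arbitrary real coordinates); it is full-dimensional if its affine span is $\mathbb{R}^d$. For polytopes $P \subset \mathbb{R}^m$ and $Q \subset \mathbb{R}^n$, each containing the origin (possibly on the boundary), the free sum is \[ P \oplus Q := \operatorname{conv}\bigl(\{(p,\mathbf{0}) : p \in P\} \cup \{(\mathbf{0},q) : q \in Q\}\bigr) \subset \mathbb{R}^{m+n}. \] The normalized volume of a polytope $R \subset \mathbb{R}^d$ is $\operatorname{Vol}_d(R) := d!\,\operatorname{vol}_d(R)$, where $\operatorname{vol}_d$ is the standard $d$-dimensional Euclidean volume (Lebesgue measure) on $\mathbb{R}^d$. *)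

theory Defs
  imports "HOL-Analysis.Analysis"
begin

definition full_dimensional :: "'a::euclidean_space set \<Rightarrow> bool" where
  "full_dimensional P \<longleftrightarrow> affine hull P = UNIV"

text \<open>
  The ambient space of the free sum, of dimension \<open>m + n\<close>, is the product type: it carries the
  standard inner product and Lebesgue measure, and \<open>DIM('a \<times> 'b) = DIM('a) + DIM('b)\<close>.
  The free sum is meant for polytopes containing the origin; the definition itself does not
  impose this.
\<close>

definition free_sum ::
    "'a::euclidean_space set \<Rightarrow> 'b::euclidean_space set \<Rightarrow> ('a \<times> 'b) set" where
  "free_sum P Q = convex hull ({(p, 0) | p. p \<in> P} \<union> {(0, q) | q. q \<in> Q})"

definition normalized_volume :: "'a::euclidean_space set \<Rightarrow> real" where
  "normalized_volume R = fact DIM('a) * measure lebesgue R"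

end

theory Submission
  imports Defs "HOL-Probability.Distributions"
begin

text \<open>
  For a convex body \<open>S\<close> containing the origin, with gauge \<open>g\<close>, slicing \<open>exp (- g x)\<close> by its
  superlevel sets, the dilates \<open>s S\<close>, gives
  \<open>\<integral> exp (- g x) dx = \<integral>\<^sub>0\<^sup>\<infinity> exp (- s) vol (s S) ds = d! vol S\<close>.
  So the normalized volume is the integral of \<open>exp (- g)\<close>. The gauge of a free sum at
  \<open>(x, y)\<close> is the sum of the gauges at \<open>x\<close> and \<open>y\<close>, so its exponential splits as a product, and
  the theorem is Fubini's. No gauge with values in \<open>[0, \<infinity>]\<close> is needed: \<open>exp (- g x)\<close> is the
  integral of \<open>exp (- s)\<close> over the \<open>s\<close> with \<open>x \<in> s S\<close>, which is 0 if there are none.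
\<close>

text \<open>The infimum of this set is the gauge of \<open>S\<close> at \<open>x\<close>. The image
  form gives the right value at \<open>s = 0\<close>, where \<open>x /\<^sub>R 0 = 0\<close> would
  admit every \<open>x\<close> once \<open>0 \<in> S\<close>.\<close>

definition dilations :: "'a::euclidean_space set \<Rightarrow> 'a \<Rightarrow> real set" where
  "dilations S x = {s. 0 \<le> s \<and> x \<in> (*\<^sub>R) s ` S}"

definition exp_gauge :: "'a::euclidean_space set \<Rightarrow> 'a \<Rightarrow> ennreal" where
  "exp_gauge S x = (\<integral>\<^sup>+ s. ennreal (exp (- s)) * indicator (dilations S x) s \<partial>lborel)"

lemma emeasure_lborel_dilation:
  fixes S :: "'a::euclidean_space set"
  assumes S: "S \<in> sets borel" and s: "s > 0"
  shows "(\<integral>\<^sup>+ x. indicator S (x /\<^sub>R s) \<partial>lborel) = ennreal (s ^ DIM('a)) * emeasure lborel S"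
proof -
  \<comment> \<open>\<open>lborel\<close> is replaced by its own image under scaling by
    \<open>s\<close>, with density \<open>s ^ DIM('a)\<close>; the scaling then cancels the
    division.\<close>
  have "(\<integral>\<^sup>+ x. indicator S (x /\<^sub>R s) \<partial>(lborel :: 'a measure))
      = (\<integral>\<^sup>+ x. indicator S (x /\<^sub>R s) \<partial>density (distr lborel borel (\<lambda>x::'a. 0 + s *\<^sub>R x)) (\<lambda>_. \<bar>s\<bar>^DIM('a)))"
    using lborel_affine[of s "0::'a"] s by simp
  also have "\<dots> = (\<integral>\<^sup>+ x. ennreal (s ^ DIM('a)) * indicator S x \<partial>lborel)"
    using s S by (subst nn_integral_density) (auto simp: nn_integral_distr)
  also have "\<dots> = ennreal (s ^ DIM('a)) * emeasure lborel S"
    using S by (simp add: nn_integral_cmult_indicator)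
  finally show ?thesis .
qed

text \<open>Off the null point \<open>s = 0\<close>, lying in a dilate means
  \<open>x /\<^sub>R s \<in> S\<close>. This form is jointly measurable in \<open>s\<close> and
  \<open>x\<close>, as Fubini requires.\<close>

lemma exp_gauge_eq:
  "exp_gauge S x = (\<integral>\<^sup>+ s. ennreal (exp (- s)) * (indicator {0<..} s * indicator S (x /\<^sub>R s)) \<partial>lborel)"
  unfolding exp_gauge_def
proof (rule nn_integral_cong_AE)
  have "indicator (dilations S x) s = (indicator {0<..} s * indicator S (x /\<^sub>R s) :: ennreal)"
    if "s \<noteq> 0" for s
    using that by (force simp: dilations_def indicator_def image_iff)
  then show "AE s in lborel. ennreal (exp (- s)) * indicator (dilations S x) s
      = ennreal (exp (- s)) * (indicator {0<..} s * indicator S (x /\<^sub>R s))"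
    using AE_lborel_singleton[of "0::real"] by (auto elim: eventually_mono)
qed

lemma measurable_exp_gauge_integrand:
  fixes S :: "'a::euclidean_space set"
  assumes [measurable]: "S \<in> sets borel"
  shows "(\<lambda>(s, x). ennreal (exp (- s)) * (indicator {0<..} s * indicator S (x /\<^sub>R s)))
    \<in> borel_measurable (lborel \<Otimes>\<^sub>M (lborel :: 'a measure))"
  by measurable

lemma borel_measurable_exp_gauge:
  fixes S :: "'a::euclidean_space set"
  assumes [measurable]: "S \<in> sets borel"
  shows "exp_gauge S \<in> borel_measurable borel"
  unfolding exp_gauge_eq[abs_def] by measurable

lemma nn_integral_exp_gauge:
  fixes S :: "'a::euclidean_space set"
  assumes S: "S \<in> sets borel"
  shows "(\<integral>\<^sup>+ x. exp_gauge S x \<partial>lborel) = ennreal (fact DIM('a)) * emeasure lborel S"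
proof -
  have "(\<integral>\<^sup>+ x. exp_gauge S x \<partial>lborel)
      = (\<integral>\<^sup>+ s. \<integral>\<^sup>+ x. ennreal (exp (- s)) * (indicator {0<..} s * indicator S (x /\<^sub>R s)) \<partial>lborel \<partial>lborel)"
    unfolding exp_gauge_eq
    by (rule lborel_pair.Fubini'[OF measurable_exp_gauge_integrand[OF S]])
  also have "\<dots> = (\<integral>\<^sup>+ s. ennreal (s ^ DIM('a) * exp (- s)) * indicator {0..} s * emeasure lborel S \<partial>lborel)"
  proof (rule nn_integral_cong)
    fix s :: real
    show "(\<integral>\<^sup>+ x. ennreal (exp (- s)) * (indicator {0<..} s * indicator S (x /\<^sub>R s)) \<partial>lborel)
        = ennreal (s ^ DIM('a) * exp (- s)) * indicator {0..} s * emeasure lborel S"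
    proof (cases "s > 0")
      case True
      have [measurable]: "S \<in> sets borel" by (fact S)
      show ?thesis
        using True by (simp add: nn_integral_cmult emeasure_lborel_dilation[OF S] ennreal_mult ac_simps)
    next
      case False
      \<comment> \<open>At \<open>s = 0\<close> the right side vanishes too, because
        \<open>DIM('a)\<close> is positive.\<close>
      then show ?thesis
        by (cases "s = 0") auto
    qed
  qed
  \<comment> \<open>Euler's Gamma integral of \<open>s ^ d * exp (- s)\<close> over the half-line
    produces the factorial.\<close>
  also have "\<dots> = ennreal (fact DIM('a)) * emeasure lborel S"
    by (subst nn_integral_multc) (auto simp: nn_intergal_power_times_exp_Ici)
  finally show ?thesis .
qed

lemma normalized_volume_eq_nn_integral:
  fixes S :: "'a::euclidean_space set"
  assumes "compact S"
  shows "ennreal (normalized_volume S) = (\<integral>\<^sup>+ x. exp_gauge S x \<partial>lborel)"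
proof -
  have S: "S \<in> sets borel"
    using assms by (simp add: borel_compact)
  have "emeasure lborel S \<noteq> \<infinity>"
    using emeasure_compact_finite[OF assms] by simp
  then have "emeasure lborel S = ennreal (measure lborel S)"
    by (simp add: emeasure_eq_ennreal_measure)
  then show ?thesis
    using S by (simp add: nn_integral_exp_gauge normalized_volume_def ennreal_mult)
qed

lemma normalized_volume_nonneg: "0 \<le> normalized_volume S"
  by (simp add: normalized_volume_def)

lemma nn_integral_exp_minus_Ici:
  "(\<integral>\<^sup>+ s. ennreal (exp (- s)) * indicator {a..} s \<partial>lborel) = ennreal (exp (- a))" for a :: real
proof -
  have "((\<lambda>s::real. - exp (- s)) \<longlongrightarrow> 0) at_top"
    using filterlim_compose[OF exp_at_bot filterlim_uminus_at_bot_at_top, THEN tendsto_minus] by simp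
  then show ?thesis
    by (subst nn_integral_FTC_atLeast[where F = "\<lambda>s. - exp (- s)" and T = 0])
       (auto intro!: derivative_eq_intros)
qed

text \<open>Dilates of a convex set around 0 are nested: \<open>s *\<^sub>R p\<close> is
  \<open>t\<close> times the point \<open>(s / t) *\<^sub>R p\<close>, which lies on the segment
  from 0 to \<open>p\<close>.\<close>

lemma dilations_upward:
  assumes "convex S" "0 \<in> S" "s \<in> dilations S x" "s \<le> t"
  shows "t \<in> dilations S x"
proof (cases "t = 0")
  case True
  then show ?thesis using assms by (auto simp: dilations_def)
next
  case False
  from assms obtain p where p: "p \<in> S" "x = s *\<^sub>R p" "0 \<le> s"
    by (auto simp: dilations_def)
  then have t: "0 < t" using False assms by auto
  have "(s / t) *\<^sub>R p + (1 - s / t) *\<^sub>R 0 \<in> S"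
    using assms p t by (intro convexD) auto
  moreover have "x = t *\<^sub>R ((s / t) *\<^sub>R p + (1 - s / t) *\<^sub>R 0)"
    using p t by simp
  ultimately show ?thesis
    using t unfolding dilations_def by (blast intro: less_imp_le)
qed

lemma bdd_below_dilations: "bdd_below (dilations S x)"
  by (rule bdd_belowI[of _ 0]) (auto simp: dilations_def)

text \<open>Being upward closed, \<open>dilations S x\<close> is a half-line starting at its
  infimum, up to that endpoint, which has measure zero.\<close>

lemma exp_gauge_eq_Inf:
  assumes "convex S" "0 \<in> S" "dilations S x \<noteq> {}"
  shows "exp_gauge S x = ennreal (exp (- Inf (dilations S x)))"
proof -
  let ?g = "Inf (dilations S x)"
  have "indicator (dilations S x) s = (indicator {?g..} s :: ennreal)" if "s \<noteq> ?g" for s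
  proof (cases "s \<in> dilations S x")
    case True
    then show ?thesis
      by (simp add: cInf_lower bdd_below_dilations)
  next
    case False
    have "\<not> ?g < s"
      using False assms dilations_upward[OF assms(1,2)]
      by (meson cInf_less_iff bdd_below_dilations less_imp_le)
    then show ?thesis
      using False that by simp
  qed
  then have "exp_gauge S x = (\<integral>\<^sup>+ s. ennreal (exp (- s)) * indicator {?g..} s \<partial>lborel)"
    unfolding exp_gauge_def
    using AE_lborel_singleton[of ?g] by (intro nn_integral_cong_AE) (auto elim: eventually_mono)
  then show ?thesis
    by (simp add: nn_integral_exp_minus_Ici)
qed

lemma exp_gauge_empty: "dilations S x = {} \<Longrightarrow> exp_gauge S x = 0"
  by (simp add: exp_gauge_def)

lemma free_sum_eq_hull_Times: "free_sum P Q = convex hull (P \<times> {0} \<union> {0} \<times> Q)"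
  unfolding free_sum_def by (rule arg_cong[where f = "\<lambda>S. convex hull S"]) auto

text \<open>The two generating sets are convex and nonempty, so every point of the hull lies on a
  single segment joining one to the other.\<close>

lemma free_sum_eq:
  assumes "convex P" "0 \<in> P" "convex Q" "0 \<in> Q"
  shows "free_sum P Q = {(u *\<^sub>R p, v *\<^sub>R q) | u v p q. 0 \<le> u \<and> 0 \<le> v \<and> u + v = 1 \<and> p \<in> P \<and> q \<in> Q}"
proof -
  have "free_sum P Q = {u *\<^sub>R s + v *\<^sub>R t | u v s t.
      0 \<le> u \<and> 0 \<le> v \<and> u + v = 1 \<and> s \<in> P \<times> {0} \<and> t \<in> {0} \<times> Q}"
    unfolding free_sum_eq_hull_Times
    using assms by (intro convex_hull_union_two convex_Times) auto
  also have "\<dots> = {(u *\<^sub>R p, v *\<^sub>R q) | u v p q. 0 \<le> u \<and> 0 \<le> v \<and> u + v = 1 \<and> p \<in> P \<and> q \<in> Q}"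
    by (simp add: mem_Times_iff)
  finally show ?thesis .
qed

text \<open>A factor \<open>r\<close> with weights \<open>u + v = 1\<close> splits as
  \<open>s = r * u\<close> and \<open>t = r * v\<close>; conversely the weights are
  \<open>s / r\<close> and \<open>t / r\<close>, with \<open>r = 0\<close> treated apart.\<close>

lemma dilations_free_sum:
  assumes "convex P" "0 \<in> P" "convex Q" "0 \<in> Q"
  shows "dilations (free_sum P Q) (x, y) = {s + t | s t. s \<in> dilations P x \<and> t \<in> dilations Q y}"
    (is "?L = ?R")
proof (intro set_eqI iffI)
  fix r assume "r \<in> ?L"
  then obtain u v p q where uv: "0 \<le> u" "0 \<le> v" "u + v = 1" "p \<in> P" "q \<in> Q"
      and r: "0 \<le> r" "x = r *\<^sub>R u *\<^sub>R p" "y = r *\<^sub>R v *\<^sub>R q"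
    by (auto simp: dilations_def free_sum_eq[OF assms])
  have "r * u \<in> dilations P x" "r * v \<in> dilations Q y"
    using uv r by (auto simp: dilations_def)
  moreover have "r = r * u + r * v"
    using uv by (simp flip: distrib_left)
  ultimately show "r \<in> ?R" by blast
next
  fix r assume "r \<in> ?R"
  then obtain s t p q where st: "r = s + t" "0 \<le> s" "0 \<le> t" "p \<in> P" "q \<in> Q" "x = s *\<^sub>R p" "y = t *\<^sub>R q"
    by (auto simp: dilations_def)
  show "r \<in> ?L"
  proof (cases "r = 0")
    case True
    have "(0, 0) \<in> free_sum P Q"
      using assms by (auto simp: free_sum_def intro: hull_inc)
    moreover have "s = 0" "t = 0"
      using True st by auto
    ultimately show ?thesis
      using True st by (auto simp: dilations_def image_iff zero_prod_def)
  next
    case False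
    then have "((s / r) *\<^sub>R p, (t / r) *\<^sub>R q) \<in> free_sum P Q"
      unfolding free_sum_eq[OF assms] mem_Collect_eq using st
      by (intro exI[of _ "s / r"] exI[of _ "t / r"] exI[of _ p] exI[of _ q])
        (auto simp flip: add_divide_distrib)
    moreover have "(x, y) = r *\<^sub>R ((s / r) *\<^sub>R p, (t / r) *\<^sub>R q)"
      using False st by simp
    moreover have "0 \<le> r"
      using st by simp
    ultimately show ?thesis
      unfolding dilations_def by blast
  qed
qed

lemma cInf_sums:
  fixes A B :: "real set"
  assumes "A \<noteq> {}" "bdd_below A" "B \<noteq> {}" "bdd_below B"
  shows "Inf {a + b | a b. a \<in> A \<and> b \<in> B} = Inf A + Inf B" (is "Inf ?C = _")
proof (rule antisym)
  have bdd: "bdd_below ?C"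
    by (rule bdd_belowI[of _ "Inf A + Inf B"]) (auto intro!: add_mono cInf_lower assms)
  \<comment> \<open>The infima are taken one at a time: over \<open>A\<close> with \<open>b\<close>
    fixed, then over \<open>B\<close>.\<close>
  have "Inf ?C - b \<le> Inf A" if "b \<in> B" for b
  proof (rule cInf_greatest[OF assms(1)])
    fix a assume "a \<in> A"
    then have "Inf ?C \<le> a + b"
      using that by (intro cInf_lower[OF _ bdd]) auto
    then show "Inf ?C - b \<le> a" by simp
  qed
  then have "Inf ?C - Inf A \<le> Inf B"
    by (intro cInf_greatest[OF assms(3)]) (smt (verit))
  then show "Inf ?C \<le> Inf A + Inf B" by simp
  show "Inf A + Inf B \<le> Inf ?C"
    using assms by (intro cInf_greatest) (auto intro!: add_mono cInf_lower)
qed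

text \<open>Gauges add because infima of sumsets add, and the exponential turns the sum into a
  product.\<close>

lemma exp_gauge_free_sum:
  assumes "convex P" "0 \<in> P" "convex Q" "0 \<in> Q"
  shows "exp_gauge (free_sum P Q) (x, y) = exp_gauge P x * exp_gauge Q y"
proof (cases "dilations P x = {} \<or> dilations Q y = {}")
  \<comment> \<open>One gauge is infinite here, and so is that of the free sum: both sides are
    0.\<close>
  case True
  then have "dilations (free_sum P Q) (x, y) = {}"
    by (auto simp: dilations_free_sum[OF assms])
  then show ?thesis
    using True by (auto simp: exp_gauge_empty)
next
  case False
  have "convex (free_sum P Q)" "0 \<in> free_sum P Q"
    using assms by (auto simp: free_sum_def zero_prod_def intro: hull_inc)
  moreover have "dilations (free_sum P Q) (x, y) \<noteq> {}"
    using False by (auto simp: dilations_free_sum[OF assms])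
  moreover have "Inf (dilations (free_sum P Q) (x, y)) = Inf (dilations P x) + Inf (dilations Q y)"
    using False by (simp add: dilations_free_sum[OF assms] cInf_sums bdd_below_dilations)
  ultimately show ?thesis
    using False assms by (simp add: exp_gauge_eq_Inf exp_add exp_diff exp_minus ennreal_mult[symmetric] field_simps)
qed

lemma compact_free_sum:
  assumes "compact P" "compact Q"
  shows "compact (free_sum P Q)"
  unfolding free_sum_eq_hull_Times
  using assms by (intro compact_convex_hull compact_Un compact_Times) auto

text \<open>The integrals of \<open>exp_gauge\<close> absorb all three factorials, so Fubini yields
  the product with no binomial factor.\<close>

lemma normalized_volume_free_sum:
  fixes P :: "'a::euclidean_space set" and Q :: "'b::euclidean_space set"
  assumes P: "compact P" "convex P" "0 \<in> P" and Q: "compact Q" "convex Q" "0 \<in> Q"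
  shows "normalized_volume (free_sum P Q) = normalized_volume P * normalized_volume Q"
proof -
  have [measurable]: "exp_gauge P \<in> borel_measurable borel" "exp_gauge Q \<in> borel_measurable borel"
      "exp_gauge (free_sum P Q) \<in> borel_measurable borel"
    using P Q by (simp_all add: borel_measurable_exp_gauge borel_compact compact_free_sum)
  have "ennreal (normalized_volume (free_sum P Q))
      = (\<integral>\<^sup>+ z. exp_gauge (free_sum P Q) z \<partial>(lborel \<Otimes>\<^sub>M lborel))"
    using P Q by (simp add: normalized_volume_eq_nn_integral compact_free_sum lborel_prod)
  also have "\<dots> = (\<integral>\<^sup>+ x. \<integral>\<^sup>+ y. exp_gauge (free_sum P Q) (x, y) \<partial>lborel \<partial>lborel)"
    by (subst lborel.nn_integral_fst) (simp_all add: lborel_prod)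
  also have "\<dots> = (\<integral>\<^sup>+ x. exp_gauge P x \<partial>lborel) * (\<integral>\<^sup>+ y. exp_gauge Q y \<partial>lborel)"
    using P Q by (simp add: exp_gauge_free_sum nn_integral_cmult nn_integral_multc)
  also have "\<dots> = ennreal (normalized_volume P * normalized_volume Q)"
    using P Q by (simp add: normalized_volume_eq_nn_integral ennreal_mult normalized_volume_nonneg)
  finally show ?thesis
    by (simp add: normalized_volume_nonneg)
qed

theorem theorem2:
  fixes P :: "'a::euclidean_space set" and Q :: "'b::euclidean_space set"
  assumes "polytope P" and "full_dimensional P" and "0 \<in> P"
    and "polytope Q" and "full_dimensional Q" and "0 \<in> Q"
  shows "normalized_volume (free_sum P Q) = normalized_volume P * normalized_volume Q"
  using assms by (intro normalized_volume_free_sum polytope_imp_compact polytope_imp_convex)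

end
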